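(* Let $n\geq 1$ and let $X_1,\dots,X_n$ be independent Bernoulli sums. Then $$\Delta_\infty\left(\sum_{i=1}^nX_i\right)\ \leq\ 6\sum_{i=1}^n\Delta_\infty(X_i).$$
   Context: A Bernoulli random variable takes values in $\{0,1\}$ (with arbitrary parameter in $[0,1]$). A finite Bernoulli sum is a random variable with the distribution of a sum of finitely many independent (not necessarily identically distributed) Bernoulli random variables. A Bernoulli sum is a random variable whose distribution is a limit, in the sense of convergence in distribution, of distributions of finite Bernoulli sums. For an integer-valued random variable $X$ with $f_X(k)=\mathbb{P}(X=k)$, $\Delta_\infty(X)=\|f_X\|_\infty^{-2}-1$, where $\|f_X\|_\infty=\sup_{k\in\mathbb{Z}}f_X(k)$. *)

theory Defs
  imports "HOL-Probability.Probability"
begin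

definition bernoulli_rv :: "'a measure \<Rightarrow> ('a \<Rightarrow> real) \<Rightarrow> bool" where
  "bernoulli_rv M B \<longleftrightarrow> B \<in> borel_measurable M \<and> (\<forall>\<omega>\<in>space M. B \<omega> \<in> {0, 1})"

(* Laws of finite Bernoulli sums. HOL cannot quantify over the type of the sample space, so
   the witness lives on nat => real; finite_bernoulli_sum_law_distr below shows that this
   choice is no restriction. *)
definition finite_bernoulli_sum_law :: "real measure \<Rightarrow> bool" where
  "finite_bernoulli_sum_law \<mu> \<longleftrightarrow>
     (\<exists>(N :: (nat \<Rightarrow> real) measure) (m :: nat) B.
        prob_space N \<and>
        (\<forall>j<m. bernoulli_rv N (B j)) \<and>
        prob_space.indep_vars N (\<lambda>_. borel) B {..<m} \<and>
        \<mu> = distr N borel (\<lambda>\<omega>. \<Sum>j<m. B j \<omega>))"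

definition bernoulli_sum :: "'a measure \<Rightarrow> ('a \<Rightarrow> real) \<Rightarrow> bool" where
  "bernoulli_sum M X \<longleftrightarrow>
     X \<in> borel_measurable M \<and>
     (\<exists>\<mu> :: nat \<Rightarrow> real measure.
        (\<forall>r. finite_bernoulli_sum_law (\<mu> r)) \<and> weak_conv_m \<mu> (distr M borel X))"

(* Meaningful for random variables that are almost surely integer-valued; Bernoulli sums are,
   being weak limits of laws supported on the integers. *)
definition Delta_inf :: "'a measure \<Rightarrow> ('a \<Rightarrow> real) \<Rightarrow> real" where
  "Delta_inf M X =
     1 / (SUP k::int. measure M {\<omega> \<in> space M. X \<omega> = of_int k})\<^sup>2 - 1"

lemma finite_bernoulli_sum_law_distr:
  fixes M :: "'a measure" and B :: "nat \<Rightarrow> 'a \<Rightarrow> real" and m :: nat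
  assumes "prob_space M"
    and B: "\<forall>j<m. bernoulli_rv M (B j)"
    and ind: "prob_space.indep_vars M (\<lambda>_. borel) B {..<m}"
  shows "finite_bernoulli_sum_law (distr M borel (\<lambda>\<omega>. \<Sum>j<m. B j \<omega>))"
proof -
  interpret M: prob_space M by fact
  define P where "P = PiM {..<m} (\<lambda>_. borel :: real measure)"
  define f where "f = (\<lambda>\<omega>. \<lambda>j\<in>{..<m}. B j \<omega>)"
  define N where "N = distr M P f"
  define C where "C = (\<lambda>(j::nat) (x::nat \<Rightarrow> real). if x j = 1 then 1 else 0 :: real)"
  have Bm: "B j \<in> borel_measurable M" and B01: "\<And>\<omega>. \<omega> \<in> space M \<Longrightarrow> B j \<omega> \<in> {0,1}"
    if "j < m" for j
    using B that unfolding bernoulli_rv_def by blast+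
  have f: "f \<in> measurable M P"
    unfolding f_def P_def by (rule measurable_restrict) (auto intro: Bm)
  interpret N: prob_space N
    unfolding N_def by (rule M.prob_space_distr[OF f])
  have Cm: "C j \<in> borel_measurable P" if "j < m" for j
  proof -
    have [measurable]: "(\<lambda>x. x j) \<in> borel_measurable P"
      unfolding P_def using that by (intro measurable_component_singleton) auto
    show ?thesis unfolding C_def by measurable
  qed
  have CmN: "C j \<in> borel_measurable N" if "j < m" for j
    using Cm[OF that] by (simp add: N_def)
  have Cf: "C j (f \<omega>) = B j \<omega>" if "j < m" "\<omega> \<in> space M" for j \<omega>
    using B01[OF that] that by (auto simp: C_def f_def)
  have "N.indep_vars (\<lambda>_. borel) C {..<m}"
  proof (cases "m = 0")
    case True
    then show ?thesis
      by (simp add: N.indep_vars_def N.indep_sets_def)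
  next
    case False
    have eq: "distr N P (\<lambda>x. \<lambda>j\<in>{..<m}. C j x) = distr M P f"
    proof -
      have h: "(\<lambda>x. \<lambda>j\<in>{..<m}. C j x) \<in> measurable P P"
        unfolding P_def by (rule measurable_restrict) (use Cm P_def in auto)
      show ?thesis unfolding N_def
        by (subst distr_distr[OF h f], rule distr_cong)
          (auto simp: f_def fun_eq_iff Cf[unfolded f_def] restrict_def dest!: B01 simp: C_def)
    qed
    have eq1: "distr N borel (C j) = distr M borel (B j)" if "j < m" for j
      unfolding N_def
      by (subst distr_distr[OF Cm[OF that] f], rule distr_cong) (auto simp: Cf that)
    have "distr M P f = PiM {..<m} (\<lambda>j. distr M borel (B j))"
      using ind False unfolding P_def f_def
      by (subst (asm) M.indep_vars_iff_distr_eq_PiM') (auto intro: Bm)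
    also have "\<dots> = PiM {..<m} (\<lambda>j. distr N borel (C j))"
      by (intro PiM_cong) (auto simp: eq1)
    finally show ?thesis
      using False eq unfolding P_def
      by (subst N.indep_vars_iff_distr_eq_PiM') (auto intro: CmN)
  qed
  moreover have "\<forall>j<m. bernoulli_rv N (C j)"
    using CmN by (auto simp: bernoulli_rv_def C_def)
  moreover have "distr M borel (\<lambda>\<omega>. \<Sum>j<m. B j \<omega>) = distr N borel (\<lambda>x. \<Sum>j<m. C j x)"
  proof -
    have h: "(\<lambda>x. \<Sum>j<m. C j x) \<in> borel_measurable P"
      by (intro borel_measurable_sum Cm) auto
    show ?thesis unfolding N_def
      by (subst distr_distr[OF h f], rule distr_cong) (auto simp: Cf)
  qed
  ultimately show ?thesis
    unfolding finite_bernoulli_sum_law_def using N.prob_space_axioms by blast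
qed

end

(*
  For integer-valued Y with maximal mass L, spreading each atom uniformly over a unit interval
  shows 1 / L^2 - 1 <= 12 Var Y, so by additivity of the variance it suffices that a Bernoulli sum
  has 2 Var X <= Delta_inf X. For a finite sum of variance l the characteristic function satisfies
  |phi(t)| <= exp (- l (1 - cos t)) <= 1 / (1 + l (1 - cos t)). The last function is a multiple of
  the Poisson kernel with mean value 1 / sqrt (1 + 2 l), which by Fourier inversion bounds every
  point mass. For weak limits, the means and variances of the approximating sums stay bounded, and
  along a subsequence on which both converge the integrality, the second moment bound and the bound
  on the characteristic function are inherited by the limit.
*)

theory Submission
  imports Defs
begin

section \<open>Variance of integer-valued variables with bounded point masses\<close>

text \<open>An antiderivative of \<open>max 0 (\<rho>\<^sup>2 - x\<^sup>2)\<close>.\<close>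

definition clamped_cubic :: "real \<Rightarrow> real \<Rightarrow> real" where
  "clamped_cubic \<rho> x = (let y = max (-\<rho>) (min \<rho> x) in \<rho>\<^sup>2 * y - y ^ 3 / 3)"

text \<open>The derivative \<open>\<rho>^2 - x^2\<close> is nonnegative on
  \<open>[-\<rho>, \<rho>]\<close>; algebraically, \<open>b - a\<close> is factored out of the
  difference and the cofactor is nonnegative.\<close>

lemma cubic_mono:
  fixes \<rho> a b :: real
  assumes "- \<rho> \<le> a" "a \<le> b" "b \<le> \<rho>"
  shows "\<rho>\<^sup>2 * a - a ^ 3 / 3 \<le> \<rho>\<^sup>2 * b - b ^ 3 / 3"
proof -
  have "a\<^sup>2 \<le> \<rho>\<^sup>2" "b\<^sup>2 \<le> \<rho>\<^sup>2"
    using assms by (auto simp: abs_le_square_iff[symmetric])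
  moreover have "a * b \<le> (a\<^sup>2 + b\<^sup>2) / 2"
    using sum_squares_bound[of a b] by simp
  ultimately have "0 \<le> (b - a) * (\<rho>\<^sup>2 - (a\<^sup>2 + a * b + b\<^sup>2) / 3)"
    using assms by (intro mult_nonneg_nonneg) auto
  also have "\<dots> = (\<rho>\<^sup>2 * b - b ^ 3 / 3) - (\<rho>\<^sup>2 * a - a ^ 3 / 3)"
    by (simp add: field_simps power2_eq_square power3_eq_cube)
  finally show ?thesis by simp
qed

lemma mono_clamped_cubic: "\<rho> \<ge> 0 \<Longrightarrow> mono (clamped_cubic \<rho>)"
  unfolding clamped_cubic_def Let_def by (intro monoI cubic_mono) auto

text \<open>Here the derivative is \<open>x^2 - \<rho>^2\<close>, nonnegative outside
  \<open>(-\<rho>, \<rho>)\<close>; the disjunction keeps both points on the same side of that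
  interval.\<close>

lemma cubic_excess_mono:
  fixes \<rho> x y :: real
  assumes "\<rho> \<ge> 0" "x \<le> y" "\<rho> \<le> x \<or> y \<le> -\<rho>"
  shows "x ^ 3 / 3 - \<rho>\<^sup>2 * x \<le> y ^ 3 / 3 - \<rho>\<^sup>2 * y"
proof -
  have "\<rho>\<^sup>2 \<le> x\<^sup>2" "\<rho>\<^sup>2 \<le> y\<^sup>2"
    using assms by (auto simp: abs_le_square_iff[symmetric])
  moreover have "\<rho> * \<rho> \<le> x * y"
    using assms mult_mono[of \<rho> x \<rho> y] mult_mono[of \<rho> "-x" \<rho> "-y"] by auto
  ultimately have "0 \<le> (y - x) * ((x\<^sup>2 + x * y + y\<^sup>2) / 3 - \<rho>\<^sup>2)"
    using assms by (intro mult_nonneg_nonneg) (auto simp: power2_eq_square)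
  also have "\<dots> = (y ^ 3 / 3 - \<rho>\<^sup>2 * y) - (x ^ 3 / 3 - \<rho>\<^sup>2 * x)"
    by (simp add: field_simps power2_eq_square power3_eq_cube)
  finally show ?thesis by simp
qed

text \<open>The function compared is an antiderivative of \<open>max 0 (x^2 - \<rho>^2)\<close>, the
  amount by which \<open>max 0 (\<rho>^2 - x^2)\<close> exceeds \<open>\<rho>^2 - x^2\<close>. It
  vanishes on \<open>[-\<rho>, \<rho>]\<close> and is treated piece by piece.\<close>

lemma clamped_cubic_excess_mono:
  fixes \<rho> x y :: real
  assumes "\<rho> \<ge> 0" "x \<le> y"
  shows "clamped_cubic \<rho> x + x ^ 3 / 3 - \<rho>\<^sup>2 * x \<le> clamped_cubic \<rho> y + y ^ 3 / 3 - \<rho>\<^sup>2 * y"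
proof -
  define h where "h z = clamped_cubic \<rho> z + z ^ 3 / 3 - \<rho>\<^sup>2 * z" for z
  have hi: "h z = 2 / 3 * \<rho> ^ 3 + (z ^ 3 / 3 - \<rho>\<^sup>2 * z)" if "\<rho> \<le> z" for z
    using that assms by (simp add: h_def clamped_cubic_def power2_eq_square power3_eq_cube max_def)
  have lo: "h z = - (2 / 3 * \<rho> ^ 3) + (z ^ 3 / 3 - \<rho>\<^sup>2 * z)" if "z \<le> -\<rho>" for z
    using that assms by (simp add: h_def clamped_cubic_def power2_eq_square power3_eq_cube max_def)
  have mid: "h z = 0" if "-\<rho> \<le> z" "z \<le> \<rho>" for z
    using that by (simp add: h_def clamped_cubic_def)
  have hi0: "0 \<le> h z" if "\<rho> \<le> z" for z
    using cubic_excess_mono[of \<rho> \<rho> z] assms that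
    by (simp add: hi power2_eq_square power3_eq_cube)
  have lo0: "h z \<le> 0" if "z \<le> -\<rho>" for z
    using cubic_excess_mono[of \<rho> z "-\<rho>"] assms that
    by (simp add: lo power2_eq_square power3_eq_cube)
  have "h x \<le> h y"
  proof -
    consider "\<rho> \<le> x" | "y \<le> -\<rho>" | "x \<le> \<rho>" "-\<rho> \<le> y" by linarith
    then show ?thesis
    proof cases
      case 1 then show ?thesis using cubic_excess_mono[of \<rho> x y] assms by (simp add: hi)
    next
      case 2 then show ?thesis using cubic_excess_mono[of \<rho> x y] assms by (simp add: lo)
    next
      case 3
      have "h x \<le> 0" using 3 lo0[of x] mid[of x] by linarith
      moreover have "0 \<le> h y" using 3 hi0[of y] mid[of y] by linarith
      ultimately show ?thesis by simp
    qed
  qed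
  then show ?thesis by (simp add: h_def)
qed

text \<open>The left side is the integral of \<open>\<rho>^2 - y^2\<close> over the unit interval
  centred at \<open>x\<close>, where 1/12 is the variance of the uniform law on that interval;
  taking the positive part can only increase the integral.\<close>

lemma clamped_cubic_diff_ge:
  assumes "\<rho> \<ge> 0"
  shows "\<rho>\<^sup>2 - 1 / 12 - x\<^sup>2 \<le> clamped_cubic \<rho> (x + 1 / 2) - clamped_cubic \<rho> (x - 1 / 2)"
proof -
  have "(x + h) ^ 3 - (x - h) ^ 3 = 6 * h * x\<^sup>2 + 2 * h ^ 3" for h
    by (simp add: algebra_simps power2_eq_square power3_eq_cube)
  from this[of "1 / 2"] have "(x + 1 / 2) ^ 3 - (x - 1 / 2) ^ 3 = 3 * x\<^sup>2 + 1 / 4"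
    by (simp add: power3_eq_cube)
  moreover have "\<rho>\<^sup>2 * (x + 1 / 2) - \<rho>\<^sup>2 * (x - 1 / 2) = \<rho>\<^sup>2"
    by (simp add: right_diff_distrib[symmetric])
  ultimately have "((x + 1 / 2) ^ 3 / 3 - \<rho>\<^sup>2 * (x + 1 / 2)) - ((x - 1 / 2) ^ 3 / 3 - \<rho>\<^sup>2 * (x - 1 / 2))
      = x\<^sup>2 + 1 / 12 - \<rho>\<^sup>2"
    by linarith
  then show ?thesis
    using clamped_cubic_excess_mono[OF assms, of "x - 1 / 2" "x + 1 / 2"] by linarith
qed

lemma clamped_cubic_bounds:
  assumes "\<rho> \<ge> 0"
  shows "\<bar>clamped_cubic \<rho> x\<bar> \<le> 2 / 3 * \<rho> ^ 3"
proof -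
  let ?y = "max (-\<rho>) (min \<rho> x)"
  have 1: "\<rho>\<^sup>2 * ?y - ?y ^ 3 / 3 \<le> \<rho>\<^sup>2 * \<rho> - \<rho> ^ 3 / 3"
    using assms by (intro cubic_mono) auto
  have 2: "\<rho>\<^sup>2 * - \<rho> - (- \<rho>) ^ 3 / 3 \<le> \<rho>\<^sup>2 * ?y - ?y ^ 3 / 3"
    using assms by (intro cubic_mono) auto
  have 3: "\<rho>\<^sup>2 * \<rho> = \<rho> ^ 3" "\<rho>\<^sup>2 * - \<rho> = - (\<rho> ^ 3)" "(- \<rho>) ^ 3 = - (\<rho> ^ 3)"
    by (simp_all add: power2_eq_square power3_eq_cube)
  show ?thesis
    using 1 2 3 unfolding clamped_cubic_def Let_def abs_le_iff by linarith
qed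

lemma clamped_cubic_outside:
  assumes "\<rho> \<ge> 0" "\<rho> \<le> x \<and> \<rho> \<le> y \<or> x \<le> -\<rho> \<and> y \<le> -\<rho>"
  shows "clamped_cubic \<rho> x = clamped_cubic \<rho> y"
  using assms by (cases "\<rho> = 0") (auto simp: clamped_cubic_def max_def min_def)

text \<open>
  The choice \<open>\<rho> = 1 / (2 * L)\<close> is the half-width of the uniform density of height \<open>L\<close>, which
  minimises the variance among all densities bounded by \<open>L\<close>; the summands \<open>D\<close> are the integrals of
  the dual certificate \<open>max 0 (\<rho>\<^sup>2 - x\<^sup>2)\<close> over unit intervals, so they telescope.
\<close>

lemma (in prob_space) lattice_variance_lower_bound:
  fixes Y :: "'a \<Rightarrow> real" and c L :: real
  assumes [measurable]: "random_variable borel Y"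
    and int: "AE \<omega> in M. Y \<omega> \<in> \<int>"
    and sq: "integrable M (\<lambda>\<omega>. (Y \<omega> - c)\<^sup>2)"
    and L: "L > 0" "\<And>k::int. prob {\<omega> \<in> space M. Y \<omega> = of_int k} \<le> L"
  shows "1 / L\<^sup>2 - 1 \<le> 12 * expectation (\<lambda>\<omega>. (Y \<omega> - c)\<^sup>2)"
proof -
  define \<rho> where "\<rho> = 1 / (2 * L)"
  have \<rho>: "\<rho> \<ge> 0" using L by (simp add: \<rho>_def)
  define G where "G = clamped_cubic \<rho>"
  define D where "D x = G (x - c + 1 / 2) - G (x - c - 1 / 2)" for x
  \<comment> \<open>For \<open>\<bar>x\<bar> > N\<close> the unit interval around
    \<open>x - c\<close> lies outside \<open>(-\<rho>, \<rho>)\<close>, so \<open>D x = 0\<close>.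
    Only the \<open>2 * N + 1\<close> integers from \<open>-N\<close> to \<open>N\<close>,
    enumerated by \<open>v\<close>, contribute.\<close>
  obtain N :: nat where N: "\<bar>c\<bar> + 1 / 2 + \<rho> \<le> real N"
    using real_arch_simple by blast
  define K where "K = 2 * N + 1"
  define v where "v j = real j - real N" for j :: nat
  let ?A = "\<lambda>j. {\<omega> \<in> space M. Y \<omega> = v j}"
  let ?S = "\<lambda>\<omega>. \<Sum>j<K. D (v j) * indicator (?A j) \<omega>"
  have Dpos: "0 \<le> D x" for x
    using monoD[OF mono_clamped_cubic[OF \<rho>]] by (simp add: D_def G_def)
  have Dzero: "D x = 0" if "\<bar>x\<bar> > real N" for x
    unfolding D_def G_def using that N by (subst clamped_cubic_outside[OF \<rho>]) auto
  have DS: "AE \<omega> in M. D (Y \<omega>) \<le> ?S \<omega>"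
    using int AE_space
  proof eventually_elim
    fix \<omega> assume "Y \<omega> \<in> \<int>" "\<omega> \<in> space M"
    then obtain k :: int where k: "Y \<omega> = of_int k" by (auto elim: Ints_cases)
    show "D (Y \<omega>) \<le> ?S \<omega>"
    proof (cases "\<bar>Y \<omega>\<bar> > real N")
      case True
      then have "D (Y \<omega>) = 0" by (rule Dzero)
      also have "0 \<le> ?S \<omega>" by (intro sum_nonneg mult_nonneg_nonneg Dpos) simp
      finally show ?thesis .
    next
      case False
      then have "\<bar>k\<bar> \<le> int N" by (simp add: k)
      define j where "j = nat (k + int N)"
      have j: "j < K" "v j = Y \<omega>" using \<open>\<bar>k\<bar> \<le> int N\<close> by (auto simp: j_def v_def k K_def)
      have "D (Y \<omega>) = D (v j) * indicator (?A j) \<omega>" using j \<open>\<omega> \<in> space M\<close> by simp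
      also have "\<dots> \<le> ?S \<omega>"
        by (rule member_le_sum) (use j Dpos in auto)
      finally show ?thesis .
    qed
  qed
  have AE: "AE \<omega> in M. \<rho>\<^sup>2 - 1 / 12 - (Y \<omega> - c)\<^sup>2 \<le> ?S \<omega>"
    using DS
  proof eventually_elim
    fix \<omega> assume "D (Y \<omega>) \<le> ?S \<omega>"
    then show "\<rho>\<^sup>2 - 1 / 12 - (Y \<omega> - c)\<^sup>2 \<le> ?S \<omega>"
      using clamped_cubic_diff_ge[OF \<rho>, of "Y \<omega> - c"] by (simp add: D_def G_def)
  qed
  have "\<rho>\<^sup>2 - 1 / 12 - expectation (\<lambda>\<omega>. (Y \<omega> - c)\<^sup>2) = expectation (\<lambda>\<omega>. \<rho>\<^sup>2 - 1 / 12 - (Y \<omega> - c)\<^sup>2)"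
    using sq by (simp add: prob_space)
  also have "\<dots> \<le> expectation ?S"
  proof (rule integral_mono_AE[OF _ _ AE])
    show "integrable M ?S"
      by (intro Bochner_Integration.integrable_sum integrable_real_mult_indicator) auto
  qed (use sq in simp)
  also have "\<dots> = (\<Sum>j<K. D (v j) * prob (?A j))"
    by (subst Bochner_Integration.integral_sum) (auto simp: emeasure_eq_measure)
  also have "\<dots> \<le> (\<Sum>j<K. D (v j) * L)"
  proof (intro sum_mono mult_left_mono Dpos)
    fix j
    show "prob (?A j) \<le> L" using L(2)[of "int j - int N"] by (simp add: v_def)
  qed
  \<comment> \<open>Consecutive values of \<open>v\<close> differ by 1, so the right end of one unit
    interval is the left end of the next.\<close>
  also have "\<dots> = L * (\<Sum>j<K. G (real (Suc j) - real N - c - 1 / 2) - G (real j - real N - c - 1 / 2))"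
    unfolding sum_distrib_left by (intro sum.cong) (auto simp: D_def v_def algebra_simps)
  also have "\<dots> = L * (G (real (K) - real N - c - 1 / 2) - G (real 0 - real N - c - 1 / 2))"
    by (subst sum_lessThan_telescope) (rule refl)
  also have "\<dots> \<le> L * (4 / 3 * \<rho> ^ 3)"
    using L clamped_cubic_bounds[OF \<rho>, of "real (K) - real N - c - 1 / 2"]
      clamped_cubic_bounds[OF \<rho>, of "real 0 - real N - c - 1 / 2"]
    unfolding G_def by (intro mult_left_mono) linarith+
  \<comment> \<open>The total integral \<open>4 / 3 * \<rho>^3\<close> times \<open>L\<close> is 1/6
    of \<open>1 / L^2\<close>, while \<open>\<rho>^2\<close> is 1/4 of it; the difference 1/12
    explains the factor 12 in the claim.\<close>
  also have "\<dots> = 1 / (6 * L\<^sup>2)" using L by (simp add: \<rho>_def field_simps power2_eq_square power3_eq_cube)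
  finally have "\<rho>\<^sup>2 - 1 / (6 * L\<^sup>2) \<le> 1 / 12 + expectation (\<lambda>\<omega>. (Y \<omega> - c)\<^sup>2)" by simp
  moreover have "\<rho>\<^sup>2 - 1 / (6 * L\<^sup>2) = 1 / (12 * L\<^sup>2)"
    using L by (simp add: \<rho>_def field_simps power2_eq_square)
  ultimately show ?thesis by simp
qed

section \<open>Additivity of variance and positivity of the largest point mass\<close>

lemma (in prob_space) variance_add_indep:
  fixes U V :: "'a \<Rightarrow> real"
  assumes ind: "indep_var borel U borel V"
    and U: "integrable M U" "integrable M (\<lambda>\<omega>. (U \<omega>)\<^sup>2)"
    and V: "integrable M V" "integrable M (\<lambda>\<omega>. (V \<omega>)\<^sup>2)"
  shows "integrable M (\<lambda>\<omega>. (U \<omega> + V \<omega>)\<^sup>2)"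
    and "variance (\<lambda>\<omega>. U \<omega> + V \<omega>) = variance U + variance V"
proof -
  have UV: "integrable M (\<lambda>\<omega>. U \<omega> * V \<omega>)"
    and EUV: "expectation (\<lambda>\<omega>. U \<omega> * V \<omega>) = expectation U * expectation V"
    using indep_var_integrable[OF ind U(1) V(1)] indep_var_lebesgue_integral[OF ind U(1) V(1)] by auto
  have eq: "(\<lambda>\<omega>. (U \<omega> + V \<omega>)\<^sup>2) = (\<lambda>\<omega>. (U \<omega>)\<^sup>2 + (V \<omega>)\<^sup>2 + 2 * (U \<omega> * V \<omega>))"
    by (auto simp: power2_sum algebra_simps)
  show int: "integrable M (\<lambda>\<omega>. (U \<omega> + V \<omega>)\<^sup>2)"
    unfolding eq using U V UV by auto
  have E: "expectation (\<lambda>\<omega>. (U \<omega> + V \<omega>)\<^sup>2) = expectation (\<lambda>\<omega>. (U \<omega>)\<^sup>2) + expectation (\<lambda>\<omega>. (V \<omega>)\<^sup>2)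
      + 2 * (expectation U * expectation V)"
    unfolding eq using U V UV EUV by simp
  have "variance (\<lambda>\<omega>. U \<omega> + V \<omega>)
      = expectation (\<lambda>\<omega>. (U \<omega> + V \<omega>)\<^sup>2) - (expectation U + expectation V)\<^sup>2"
    using U V int by (subst variance_eq) auto
  then show "variance (\<lambda>\<omega>. U \<omega> + V \<omega>) = variance U + variance V"
    using U V unfolding E by (simp only: variance_eq) (simp add: power2_sum)
qed

text \<open>Square integrability of the partial sums is part of the induction claim, because adding
  one more independent variable requires it.\<close>

lemma (in prob_space) variance_sum_indep:
  fixes X :: "'i \<Rightarrow> 'a \<Rightarrow> real"
  assumes "finite I" "indep_vars (\<lambda>_. borel) X I"
    and "\<And>i. i \<in> I \<Longrightarrow> integrable M (X i)" "\<And>i. i \<in> I \<Longrightarrow> integrable M (\<lambda>\<omega>. (X i \<omega>)\<^sup>2)"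
  shows "integrable M (\<lambda>\<omega>. (\<Sum>i\<in>I. X i \<omega>)\<^sup>2)"
    and "variance (\<lambda>\<omega>. \<Sum>i\<in>I. X i \<omega>) = (\<Sum>i\<in>I. variance (X i))"
proof -
  have "integrable M (\<lambda>\<omega>. (\<Sum>i\<in>I. X i \<omega>)\<^sup>2) \<and>
      variance (\<lambda>\<omega>. \<Sum>i\<in>I. X i \<omega>) = (\<Sum>i\<in>I. variance (X i))"
    using assms
  proof (induction I rule: finite_induct)
    case empty
    then show ?case by simp
  next
    case (insert i I)
    have "indep_var borel (X i) borel (\<lambda>\<omega>. \<Sum>i\<in>I. X i \<omega>)"
      using insert by (intro indep_vars_sum) auto
    moreover have "integrable M (\<lambda>\<omega>. (\<Sum>i\<in>I. X i \<omega>)\<^sup>2) \<and>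
      variance (\<lambda>\<omega>. \<Sum>i\<in>I. X i \<omega>) = (\<Sum>i\<in>I. variance (X i))"
      using insert by (auto intro!: insert.IH intro: indep_vars_subset)
    ultimately show ?case
      using variance_add_indep[of "X i" "\<lambda>\<omega>. \<Sum>i\<in>I. X i \<omega>"] insert by auto
  qed
  then show "integrable M (\<lambda>\<omega>. (\<Sum>i\<in>I. X i \<omega>)\<^sup>2)"
    "variance (\<lambda>\<omega>. \<Sum>i\<in>I. X i \<omega>) = (\<Sum>i\<in>I. variance (X i))" by auto
qed

text \<open>Countably many null atoms cannot carry a probability measure. Positivity rules out the
  default value of division by zero in \<open>Delta_inf\<close> and permits taking
  reciprocals.\<close>

lemma (in prob_space) lattice_sup_pos:
  fixes Y :: "'a \<Rightarrow> real"
  assumes [measurable]: "Y \<in> borel_measurable M" and int: "AE \<omega> in M. Y \<omega> \<in> \<int>"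
  shows "0 < (SUP k::int. prob {\<omega> \<in> space M. Y \<omega> = of_int k})"
proof -
  let ?A = "\<lambda>k::int. {\<omega> \<in> space M. Y \<omega> = of_int k}"
  have "\<not> (\<forall>k. prob (?A k) = 0)"
  proof
    assume "\<forall>k. prob (?A k) = 0"
    then have "AE \<omega> in M. \<forall>k::int. Y \<omega> \<noteq> of_int k"
      by (subst AE_all_countable) (auto intro!: AE_I'[of "?A k" for k] simp: emeasure_eq_measure null_sets_def)
    with int have "AE \<omega> in M. False"
      by eventually_elim (auto elim: Ints_cases)
    then show False by simp
  qed
  then obtain k where "0 < prob (?A k)" by (auto simp: zero_less_measure_iff)
  also have "\<dots> \<le> (SUP k. prob (?A k))"
    by (rule cSUP_upper[OF UNIV_I bdd_aboveI2[where M=1]]) simp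
  finally show ?thesis .
qed

section \<open>The Poisson kernel and Fourier inversion on the integers\<close>

text \<open>The derivative equals \<open>(1 - r^2) / (s * (1 - 2 * r * cos t + r^2))\<close>, the
  Poisson kernel of radius \<open>r\<close> divided by \<open>s\<close>. The arctan is minus the
  argument of \<open>1 - r * exp (i * t)\<close>; as \<open>r < 1\<close> this number has positive
  real part, so the antiderivative is smooth on the whole line.\<close>

lemma poisson_kernel_derivative:
  fixes l t :: real
  assumes "l \<ge> 0"
  defines "s \<equiv> sqrt (1 + 2 * l)"
  defines "r \<equiv> (s - 1) / (s + 1)"
  shows "((\<lambda>t. (t + 2 * arctan (r * sin t / (1 - r * cos t))) / s)
    has_real_derivative 1 / (1 + l * (1 - cos t))) (at t)"
proof -
  have s: "s \<ge> 1" "s\<^sup>2 = 1 + 2 * l" using assms by (auto simp: s_def)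
  have r: "0 \<le> r" "r < 1" using s by (auto simp: r_def)
  have "r * cos t \<le> r" using r cos_le_one[of t] mult_left_mono[of "cos t" 1 r] by simp
  then have d: "1 - r * cos t > 0" using r by simp
  \<comment> \<open>This is the squared modulus of \<open>1 - r * exp (i * t)\<close>.\<close>
  define q where "q = 1 - 2 * r * cos t + r\<^sup>2"
  have q: "q = (1 - r * cos t)\<^sup>2 + (r * sin t)\<^sup>2"
  proof -
    have "(1 - r * c)\<^sup>2 + (r * u)\<^sup>2 = 1 - 2 * r * c + r\<^sup>2 * (u\<^sup>2 + c\<^sup>2)" for c u
      by (simp add: algebra_simps power2_eq_square)
    from this[of "cos t" "sin t"] show ?thesis by (simp add: q_def)
  qed
  have q0: "q > 0" unfolding q using d by (intro add_pos_nonneg) auto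
  have "((\<lambda>t. r * sin t / (1 - r * cos t)) has_real_derivative
      (r * cos t * (1 - r * cos t) - r * sin t * (r * sin t)) / (1 - r * cos t)\<^sup>2) (at t)"
    using d by (auto intro!: derivative_eq_intros simp: power2_eq_square)
  then have "((\<lambda>t. (t + 2 * arctan (r * sin t / (1 - r * cos t))) / s) has_real_derivative
      (1 + 2 * (inverse (1 + (r * sin t / (1 - r * cos t))\<^sup>2) *
        ((r * cos t * (1 - r * cos t) - r * sin t * (r * sin t)) / (1 - r * cos t)\<^sup>2))) / s) (at t)"
    by (intro DERIV_cdivide DERIV_add DERIV_ident DERIV_cmult DERIV_chain2[OF DERIV_arctan])
  also have "1 + (r * sin t / (1 - r * cos t))\<^sup>2 = q / (1 - r * cos t)\<^sup>2"
    using d by (simp add: q field_simps)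
  also have "r * cos t * (1 - r * cos t) - r * sin t * (r * sin t) = r * cos t - r\<^sup>2"
  proof -
    have "r * c * (1 - r * c) - r * u * (r * u) = r * c - r\<^sup>2 * (u\<^sup>2 + c\<^sup>2)" for c u
      by (simp add: algebra_simps power2_eq_square)
    from this[of "cos t" "sin t"] show ?thesis by simp
  qed
  also have "(1 + 2 * (inverse (q / (1 - r * cos t)\<^sup>2) * ((r * cos t - r\<^sup>2) / (1 - r * cos t)\<^sup>2))) / s
      = (1 - r\<^sup>2) / (s * q)"
    using d q0 s by (simp add: field_simps) (simp add: q_def algebra_simps)
  also have "\<dots> = 1 / (1 + l * (1 - cos t))"
  proof -
    \<comment> \<open>Multiplying numerator and denominator by \<open>(s + 1)^2\<close> eliminates
      \<open>r\<close> through \<open>r * (s + 1) = s - 1\<close>; then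
      \<open>s^2 = 1 + 2 * l\<close> gives the stated form.\<close>
    have rs: "r * (s + 1) = s - 1" using s by (simp add: r_def)
    have "(s + 1)\<^sup>2 * (1 - r\<^sup>2) = (s + 1)\<^sup>2 - (r * (s + 1))\<^sup>2"
      by (simp only: power_mult_distrib) (simp add: algebra_simps)
    also have "\<dots> = 4 * s"
      unfolding rs by (simp add: power2_eq_square algebra_simps)
    finally have "(s + 1)\<^sup>2 * (1 - r\<^sup>2) = 4 * s" .
    moreover have "(s + 1)\<^sup>2 * q = 4 * (1 + l * (1 - cos t))"
    proof -
      have "(s + 1)\<^sup>2 * q = (s + 1)\<^sup>2 - 2 * cos t * (s + 1) * (r * (s + 1)) + (r * (s + 1))\<^sup>2"
        by (simp add: q_def power2_eq_square algebra_simps)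
      also have "\<dots> = 4 + 2 * (s\<^sup>2 - 1) * (1 - cos t)"
        unfolding rs by (simp add: power2_eq_square algebra_simps)
      also have "\<dots> = 4 * (1 + l * (1 - cos t))"
        using s by simp
      finally show ?thesis .
    qed
    moreover have "(1 - r\<^sup>2) / (s * q) = ((s + 1)\<^sup>2 * (1 - r\<^sup>2)) / (s * ((s + 1)\<^sup>2 * q))"
      using s q0 by simp
    ultimately have "(1 - r\<^sup>2) / (s * q) = 4 * s / (s * (4 * (1 + l * (1 - cos t))))"
      by (simp only:)
    moreover have "4 * s / (s * (4 * x)) = 1 / x" for x
      using s by simp
    ultimately show ?thesis by (simp only:)
  qed
  finally show ?thesis .
qed

lemma poisson_kernel_integral:
  fixes l :: real
  assumes l: "l \<ge> 0"
  shows "set_integrable lborel {-pi..pi} (\<lambda>t. 1 / (1 + l * (1 - cos t)))"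
    and "(LBINT t:{-pi..pi}. 1 / (1 + l * (1 - cos t))) = 2 * pi / sqrt (1 + 2 * l)"
proof -
  have ne: "1 + l * (1 - cos t) \<noteq> 0" for t
    using l cos_le_one[of t] mult_nonneg_nonneg[of l "1 - cos t"] by linarith
  have c: "continuous_on {-pi..pi} (\<lambda>t. 1 / (1 + l * (1 - cos t)))"
    using ne by (intro continuous_intros) auto
  then show "set_integrable lborel {-pi..pi} (\<lambda>t. 1 / (1 + l * (1 - cos t)))"
    by (rule borel_integrable_atLeastAtMost')
  define F where "F r s t = (t + 2 * arctan (r * sin t / (1 - r * cos t))) / s" for r s t :: real
  let ?s = "sqrt (1 + 2 * l)"
  let ?r = "(?s - 1) / (?s + 1)"
  have "(F ?r ?s has_vector_derivative 1 / (1 + l * (1 - cos t))) (at t within {-pi..pi})" for t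
    using poisson_kernel_derivative[OF l, of t]
    unfolding F_def has_real_derivative_iff_has_vector_derivative
    by (rule has_vector_derivative_at_within)
  then have "(LBINT t:{-pi..pi}. 1 / (1 + l * (1 - cos t))) = F ?r ?s pi - F ?r ?s (-pi)"
    unfolding set_lebesgue_integral_def by (intro integral_FTC_atLeastAtMost c) auto
  \<comment> \<open>The arctan terms vanish at both ends because the sine does; only the linear term
    contributes.\<close>
  also have "\<dots> = 2 * pi / ?s"
    by (simp add: F_def diff_divide_distrib[symmetric])
  finally show "(LBINT t:{-pi..pi}. 1 / (1 + l * (1 - cos t))) = 2 * pi / ?s" .
qed

lemma iexp_integral_int:
  fixes n :: int
  shows "(CLBINT t:{-pi..pi}. iexp (t * of_int n)) = (if n = 0 then 2 * pi else 0)"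
proof (cases "n = 0")
  case True
  then show ?thesis by (simp add: set_lebesgue_integral_def scaleR_conv_of_real)
next
  case False
  have "(CLBINT t:{-pi..pi}. iexp (t * of_int n))
      = iexp (pi * of_int n) / (\<i> * of_int n) - iexp (- pi * of_int n) / (\<i> * of_int n)"
    unfolding set_lebesgue_integral_def
    using False
  proof (intro integral_FTC_atLeastAtMost continuous_intros)
    fix t :: real
    define w :: complex where "w = \<i> * of_int n"
    have "w \<noteq> 0" using False by (simp add: w_def)
    then have "((\<lambda>z. exp (z * w) / w) has_field_derivative exp (of_real t * w)) (at (of_real t))"
      by (auto intro!: derivative_eq_intros)
    from has_vector_derivative_real_field[OF this]
    show "((\<lambda>t. iexp (t * of_int n) / (\<i> * of_int n)) has_vector_derivative
        iexp (t * of_int n)) (at t within {-pi..pi})" by (simp add: w_def mult_ac)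
  qed simp
  also have "iexp (pi * of_int n) = iexp (- pi * of_int n)"
    by (simp only: exp_Euler) (simp add: cos_of_real sin_of_real flip: of_real_mult)
  finally show ?thesis using False by simp
qed

text \<open>By orthogonality of the characters on \<open>[-pi, pi]\<close> and Fubini,
  \<open>2 * pi\<close> times the mass at \<open>k\<close> is the integral of
  \<open>exp (- i * t * k)\<close> times the characteristic function; the triangle inequality then
  brings in \<open>g\<close>.\<close>

lemma (in real_distribution) lattice_mass_le_char_integral:
  fixes k :: int
  assumes int: "AE x in M. x \<in> \<int>"
    and g: "set_integrable lborel {-pi..pi} g" "\<And>t. norm (char M t) \<le> g t"
  shows "2 * pi * measure M {of_int k} \<le> (LBINT t:{-pi..pi}. g t)"
proof -
  interpret P: pair_sigma_finite lborel M ..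
  let ?f = "\<lambda>t x. indicator {-pi..pi} t *\<^sub>R iexp (t * (x - of_int k)) :: complex"
  have "2 * pi * measure M {of_int k} = (CLINT x|M. 2 * pi * indicator {of_int k} x)"
    by simp
  also have "\<dots> = (CLINT x|M. (CLBINT t:{-pi..pi}. iexp (t * (x - of_int k))))"
  proof (intro integral_cong_AE)
    show "AE x in M. complex_of_real (2 * pi * indicator {of_int k} x)
        = (CLBINT t:{-pi..pi}. iexp (t * (x - of_int k)))"
      using int
    proof eventually_elim
      fix x :: real assume "x \<in> \<int>"
      then obtain j :: int where j: "x = of_int j" by (auto elim: Ints_cases)
      have "(CLBINT t:{-pi..pi}. iexp (t * (x - of_int k))) = (if j - k = 0 then 2 * pi else 0)"
        unfolding iexp_integral_int[of "j - k", symmetric] by (simp add: j)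
      then show "complex_of_real (2 * pi * indicator {of_int k} x)
        = (CLBINT t:{-pi..pi}. iexp (t * (x - of_int k)))"
        by (auto simp: j indicator_def)
    qed
  qed (auto simp: set_lebesgue_integral_def)
  also have "\<dots> = (CLINT x|M. (CLBINT t. ?f t x))"
    by (simp add: set_lebesgue_integral_def)
  \<comment> \<open>Fubini applies because the integrand is bounded by 1 and supported on a set of
    finite product measure.\<close>
  also have "\<dots> = (CLBINT t. (CLINT x|M. ?f t x))"
  proof (intro P.Fubini_integral integrableI_bounded_set[where B=1 and A="{-pi..pi} \<times> space M"])
    show "emeasure (lborel \<Otimes>\<^sub>M M) ({-pi..pi} \<times> space M) < \<infinity>"
      using emeasure_space_1 by (subst emeasure_pair_measure_Times) (auto simp: ennreal_mult_less_top)
  qed (auto simp: indicator_def simp del: of_real_mult of_real_diff)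
  also have "\<dots> = (CLBINT t:{-pi..pi}. iexp (- (t * of_int k)) * char M t)"
    unfolding set_lebesgue_integral_def char_def
  proof (intro Bochner_Integration.integral_cong refl)
    fix t :: real
    have "iexp (t * (x - of_int k)) = iexp (- (t * of_int k)) * iexp (t * x)" for x
      by (simp add: exp_add[symmetric] algebra_simps)
    then show "(CLINT x|M. ?f t x) = indicat_real {-pi..pi} t *\<^sub>R (iexp (- (t * of_int k)) * (CLINT x|M. iexp (t * x)))"
      by (simp del: of_real_mult of_real_minus of_real_diff)
  qed
  finally have eq: "complex_of_real (2 * pi * measure M {of_int k}) =
    (CLBINT t:{-pi..pi}. iexp (- (t * of_int k)) * char M t)" .
  have "2 * pi * measure M {of_int k} = norm (complex_of_real (2 * pi * measure M {of_int k}))"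
    by (simp add: norm_mult)
  also have "\<dots> \<le> (LBINT t. norm (indicat_real {-pi..pi} t *\<^sub>R (iexp (- (t * of_int k)) * char M t)))"
    unfolding eq set_lebesgue_integral_def by (rule integral_norm_bound)
  also have "\<dots> \<le> (LBINT t:{-pi..pi}. g t)"
    unfolding set_lebesgue_integral_def
  proof (rule integral_mono')
    show "integrable lborel (\<lambda>t. indicat_real {-pi..pi} t *\<^sub>R g t)"
      using g(1) by (simp add: set_integrable_def)
    fix t
    show "norm (indicat_real {-pi..pi} t *\<^sub>R (iexp (- (t * of_int k)) * char M t))
       \<le> indicat_real {-pi..pi} t *\<^sub>R g t"
      using g(2)[of t] by (auto simp: norm_mult indicator_def simp del: of_real_mult of_real_minus)
    show "0 \<le> indicat_real {-pi..pi} t *\<^sub>R g t"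
      using order_trans[OF norm_ge_zero g(2)] by (auto simp: indicator_def)
  qed
  finally show ?thesis .
qed

section \<open>Characteristic functions of finite Bernoulli sums\<close>

text \<open>One parameter \<open>l\<close> bounds the second moment from above and forces the
  characteristic function to be small. Inequalities and an arbitrary centre \<open>m\<close> are
  used since this form passes to weak limits, and the rational bound is the one whose integral is
  explicit.\<close>

definition dispersed :: "real measure \<Rightarrow> real \<Rightarrow> real \<Rightarrow> bool" where
  "dispersed \<mu> m l \<longleftrightarrow> real_distribution \<mu> \<and> (AE x in \<mu>. x \<in> \<int>) \<and> 0 \<le> l \<and>
    integrable \<mu> (\<lambda>x. (x - m)\<^sup>2) \<and> (\<integral>x. (x - m)\<^sup>2 \<partial>\<mu>) \<le> l \<and>
    (\<forall>t. norm (char \<mu> t) \<le> 1 / (1 + l * (1 - cos t)))"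

text \<open>With success probability \<open>p\<close>, the squared modulus is exactly
  \<open>1 - 2 * p * (1 - p) * (1 - cos t)\<close>, and \<open>1 + x \<le> exp x\<close>
  finishes.\<close>

lemma (in prob_space) bernoulli_char_bound:
  fixes B :: "'a \<Rightarrow> real"
  assumes B: "bernoulli_rv M B"
  shows "integrable M B" "integrable M (\<lambda>\<omega>. (B \<omega>)\<^sup>2)"
    and "norm (char (distr M borel B) t) \<le> exp (- (variance B * (1 - cos t)))"
proof -
  have [measurable]: "B \<in> borel_measurable M" and B01: "\<And>\<omega>. \<omega> \<in> space M \<Longrightarrow> B \<omega> \<in> {0, 1}"
    using B by (auto simp: bernoulli_rv_def)
  show int: "integrable M B"
    by (rule integrable_const_bound[of _ 1]) (use B01 in \<open>fastforce intro!: AE_I2\<close>, simp)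
  have sq: "(B \<omega>)\<^sup>2 = B \<omega>" if "\<omega> \<in> space M" for \<omega>
    using B01[OF that] by auto
  show int2: "integrable M (\<lambda>\<omega>. (B \<omega>)\<^sup>2)"
    using int by (subst Bochner_Integration.integrable_cong[OF refl sq]) auto
  define p where "p = expectation B"
  have "expectation (\<lambda>\<omega>. (B \<omega>)\<^sup>2) = p"
    unfolding p_def by (intro Bochner_Integration.integral_cong sq refl)
  then have var: "variance B = p * (1 - p)"
    using int int2 by (simp add: variance_eq p_def[symmetric] prob_space power2_eq_square algebra_simps)
  have "char (distr M borel B) t = (CLINT \<omega>|M. iexp (t * B \<omega>))"
    by (simp add: char_def integral_distr)
  \<comment> \<open>On the values 0 and 1 the exponential agrees with an affine function of
    \<open>B\<close>, so its expectation depends on \<open>p\<close> alone.\<close>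
  also have "\<dots> = (CLINT \<omega>|M. 1 + of_real (B \<omega>) * (iexp t - 1))"
    by (intro Bochner_Integration.integral_cong refl) (use B01 in force)
  also have "\<dots> = 1 + of_real p * (iexp t - 1)"
    using int by (simp add: p_def prob_space)
  also have "\<dots> = Complex (1 - p * (1 - cos t)) (p * sin t)"
    by (simp add: complex_eq_iff Re_exp Im_exp algebra_simps)
  finally have "(norm (char (distr M borel B) t))\<^sup>2 = (1 - p * (1 - cos t))\<^sup>2 + (p * sin t)\<^sup>2"
    by (simp add: cmod_power2)
  also have "\<dots> = 1 + - (2 * (variance B * (1 - cos t)))"
  proof -
    have "(1 - p * (1 - c))\<^sup>2 + (p * u)\<^sup>2
        = 1 + - (2 * (p * (1 - p) * (1 - c))) + p\<^sup>2 * ((u\<^sup>2 + c\<^sup>2) - 1)" for c u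
      by (simp add: algebra_simps power2_eq_square)
    from this[of "cos t" "sin t"] show ?thesis by (simp add: var)
  qed
  also have "\<dots> \<le> exp (- (2 * (variance B * (1 - cos t))))"
    by (rule exp_ge_add_one_self)
  also have "\<dots> = (exp (- (variance B * (1 - cos t))))\<^sup>2"
    by (simp add: exp_double[symmetric])
  finally show "norm (char (distr M borel B) t) \<le> exp (- (variance B * (1 - cos t)))"
    by (rule power2_le_imp_le) simp
qed

text \<open>The witnesses are the mean and the variance. By independence the characteristic
  functions multiply, so the exponents add up to the variance of the sum;
  \<open>exp x \<ge> 1 + x\<close> weakens the exponential to the rational bound.\<close>

lemma dispersed_finite_bernoulli_sum:
  assumes "finite_bernoulli_sum_law \<mu>"
  shows "\<exists>m l. dispersed \<mu> m l"
proof -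
  obtain N :: "(nat \<Rightarrow> real) measure" and n :: nat and B where
    "prob_space N" and B: "\<And>j. j < n \<Longrightarrow> bernoulli_rv N (B j)"
    and ind: "prob_space.indep_vars N (\<lambda>_. borel) B {..<n}"
    and \<mu>: "\<mu> = distr N borel (\<lambda>\<omega>. \<Sum>j<n. B j \<omega>)"
    using assms unfolding finite_bernoulli_sum_law_def by auto
  interpret N: prob_space N by fact
  let ?S = "\<lambda>\<omega>. \<Sum>j<n. B j \<omega>"
  have Bm: "B j \<in> borel_measurable N" if "j < n" for j
    using B[OF that] by (simp add: bernoulli_rv_def)
  have S[measurable]: "?S \<in> borel_measurable N"
    using Bm by (intro borel_measurable_sum) auto
  have int: "integrable N (B j)" "integrable N (\<lambda>\<omega>. (B j \<omega>)\<^sup>2)" if "j \<in> {..<n}" for j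
    using N.bernoulli_char_bound[OF B] that by auto
  have Sint: "integrable N ?S" "integrable N (\<lambda>\<omega>. (?S \<omega>)\<^sup>2)"
    and var: "N.variance ?S = (\<Sum>j<n. N.variance (B j))"
    using N.variance_sum_indep[OF _ ind int] int by auto
  define m where "m = N.expectation ?S"
  define l where "l = N.variance ?S"
  have "integrable N (\<lambda>\<omega>. (?S \<omega> - m)\<^sup>2)"
    using Sint by (simp add: power2_diff)
  moreover have "AE x in \<mu>. x \<in> \<int>"
    unfolding \<mu> using B by (subst AE_distr_iff) (auto intro!: AE_I2 Ints_sum simp: bernoulli_rv_def, force)
  moreover have l0: "0 \<le> l" unfolding l_def by (rule N.variance_positive)
  moreover have "norm (char \<mu> t) \<le> 1 / (1 + l * (1 - cos t))" for t
  proof -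
    have "norm (char \<mu> t) = (\<Prod>j<n. norm (char (distr N borel (B j)) t))"
      unfolding \<mu> N.char_distr_sum[OF ind] by (rule prod_norm[symmetric])
    also have "\<dots> \<le> (\<Prod>j<n. exp (- (N.variance (B j) * (1 - cos t))))"
      using N.bernoulli_char_bound(3)[OF B] by (intro prod_mono) auto
    also have "\<dots> = exp (- (l * (1 - cos t)))"
      by (simp add: exp_sum[symmetric] l_def var sum_distrib_right sum_negf)
    also have "\<dots> \<le> 1 / (1 + l * (1 - cos t))"
    proof -
      have "0 < 1 + l * (1 - cos t)"
        using l0 by (intro add_pos_nonneg mult_nonneg_nonneg) auto
      then show ?thesis
        using exp_ge_add_one_self[of "l * (1 - cos t)"]
        by (simp add: exp_minus divide_inverse le_imp_inverse_le)
    qed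
    finally show ?thesis .
  qed
  moreover have "(\<integral>x. (x - m)\<^sup>2 \<partial>\<mu>) = l"
    unfolding \<mu> by (subst integral_distr) (auto simp: l_def m_def)
  ultimately have "dispersed \<mu> m l"
    unfolding dispersed_def by (auto simp: \<mu> integrable_distr_eq)
  then show ?thesis by blast
qed

section \<open>Passage to weak limits\<close>

text \<open>Describes the integers as the zero set of a bounded continuous function, so that weak
  convergence can test for integrality.\<close>

lemma sin_pi_eq_0_iff: "sin (pi * x) = 0 \<longleftrightarrow> x \<in> \<int>" for x :: real
  by (auto simp: sin_zero_iff_int2 Ints_def)

text \<open>Once both parameters are bounded, each clause of \<open>dispersed\<close> passes to the
  limit along a subsequence: the characteristic functions converge pointwise, integrality is tested
  by \<open>\<bar>sin (pi * x)\<bar>\<close>, and the second moment is reached through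
  truncations.\<close>

lemma dispersed_weak_limit:
  fixes \<mu> :: "nat \<Rightarrow> real measure" and \<nu> :: "real measure"
  assumes \<mu>: "\<And>r. \<exists>m l. dispersed (\<mu> r) m l"
    and \<nu>: "real_distribution \<nu>" and conv: "weak_conv_m \<mu> \<nu>"
  shows "\<exists>m l. dispersed \<nu> m l"
proof -
  obtain m l where ml: "\<And>r. dispersed (\<mu> r) (m r) (l r)"
    using \<mu> by metis
  interpret \<nu>: real_distribution \<nu> by fact
  interpret \<mu>: real_distribution "\<mu> r" for r
    using ml by (simp add: dispersed_def)
  have l0: "0 \<le> l r" and int: "AE x in \<mu> r. x \<in> \<int>"
    and sq: "integrable (\<mu> r) (\<lambda>x. (x - m r)\<^sup>2)" "(\<integral>x. (x - m r)\<^sup>2 \<partial>\<mu> r) \<le> l r"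
    and char: "norm (char (\<mu> r) t) \<le> 1 / (1 + l r * (1 - cos t))" for r t
    using ml[of r] by (auto simp: dispersed_def)
  have charconv: "(\<lambda>r. char (\<mu> r) t) \<longlonglongrightarrow> char \<nu> t" for t
    by (rule levy_continuity1) (use conv in \<open>auto intro: \<mu>.real_distribution_axioms \<nu>\<close>)
  have weak: "(\<lambda>r. \<integral>x. f x \<partial>\<mu> r) \<longlonglongrightarrow> (\<integral>x. f x \<partial>\<nu>)"
    if "\<And>x. isCont f x" "\<And>x. norm (f x) \<le> B" for f :: "real \<Rightarrow> real" and B
    by (rule weak_conv_imp_integral_bdd_continuous_conv[OF _ _ conv])
      (use that in \<open>auto intro: \<mu>.real_distribution_axioms \<nu>\<close>)

  \<comment> \<open>Since \<open>char \<nu>\<close> is continuous with value 1 at 0, some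
    \<open>t\<close> in \<open>(0, pi)\<close> has modulus above 1/2. Eventually the same holds for
    \<open>\<mu> r\<close>, and the rational bound then forces
    \<open>l r * (1 - cos t) < 1\<close>.\<close>
  have "Bseq l"
  proof -
    have "isCont (\<lambda>t. norm (char \<nu> t)) 0"
      using \<nu>.isCont_char by (intro continuous_intros)
    then have "\<forall>\<^sub>F t in at_right 0. norm (char \<nu> t) > 1 / 2"
      unfolding isCont_def \<nu>.char_zero
      by (intro order_tendstoD) (auto intro: tendsto_within_subset filterlim_at_split[THEN iffD1])
    moreover have "\<forall>\<^sub>F t in at_right 0. t < pi"
      by (rule order_tendstoD[OF tendsto_ident_at]) simp
    ultimately have "\<forall>\<^sub>F t in at_right 0. norm (char \<nu> t) > 1 / 2 \<and> t < pi \<and> 0 < t"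
      by (intro eventually_conj eventually_at_right_less)
    then obtain t where t: "norm (char \<nu> t) > 1 / 2" "t < pi" "0 < t"
      using eventually_happens'[OF trivial_limit_at_right_real] by blast
    have c: "1 - cos t > 0"
      using cos_monotone_0_pi[of 0 t] t by simp
    have "\<forall>\<^sub>F r in sequentially. norm (char (\<mu> r) t) > 1 / 2"
      by (rule order_tendstoD[OF tendsto_norm[OF charconv]]) (rule t)
    then have "\<forall>\<^sub>F r in sequentially. norm (l r) \<le> 1 / (1 - cos t)"
    proof eventually_elim
      fix r assume "norm (char (\<mu> r) t) > 1 / 2"
      then have "1 / 2 < 1 / (1 + l r * (1 - cos t))" using char[of r t] by simp
      moreover have "0 < 1 + l r * (1 - cos t)" using l0[of r] c by (intro add_pos_nonneg) auto
      ultimately have "l r * (1 - cos t) < 1" by (simp add: field_simps)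
      then show "norm (l r) \<le> 1 / (1 - cos t)" using c l0[of r] by (simp add: field_simps)
    qed
    then show ?thesis using c by (intro BfunI)
  qed
  then obtain C where C: "C > 0" "\<And>r. l r \<le> C" by (auto elim!: BseqE simp: abs_le_iff)
  have "Bseq m"
  proof -
    \<comment> \<open>Peetre's inequality: a bounded variance around a far away mean would force
      \<open>E[1 / (1 + x\<^sup>2)]\<close> to vanish in the limit.\<close>
    let ?f = "\<lambda>x::real. 1 / (1 + x\<^sup>2)"
    have pos: "1 + x\<^sup>2 > 0" for x :: real by (simp add: add_pos_nonneg)
    have f1: "norm (?f x) \<le> 1" for x using pos[of x] by (simp add: field_simps)
    have lim: "(\<lambda>r. \<integral>x. ?f x \<partial>\<mu> r) \<longlonglongrightarrow> (\<integral>x. ?f x \<partial>\<nu>)"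
      by (rule weak[OF _ f1]) (use pos in \<open>auto intro!: continuous_intros simp: less_imp_neq[symmetric]\<close>)
    define e where "e = (\<integral>x. ?f x \<partial>\<nu>)"
    have "integrable \<nu> ?f"
      by (rule \<nu>.integrable_const_bound[of _ 1]) (use f1 in auto)
    \<comment> \<open>A strictly positive function with integral zero would make the whole space
      null.\<close>
    then have "e \<noteq> 0"
      unfolding e_def using pos
      by (subst integral_nonneg_eq_0_iff_AE) (auto simp: less_imp_le less_imp_neq[symmetric] \<nu>.AE_False)
    moreover have "e \<ge> 0" unfolding e_def using pos by (intro Bochner_Integration.integral_nonneg) (auto simp: less_imp_le)
    ultimately have e: "e > 0" by simp
    then have "\<forall>\<^sub>F r in sequentially. (\<integral>x. ?f x \<partial>\<mu> r) > e / 2"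
      using lim unfolding e_def[symmetric] by (intro order_tendstoD) auto
    then have "\<forall>\<^sub>F r in sequentially. norm (m r) \<le> 1 + 4 * (1 + C) / e"
    proof eventually_elim
      fix r assume r: "(\<integral>x. ?f x \<partial>\<mu> r) > e / 2"
      have "?f x \<le> 2 / (1 + (m r)\<^sup>2) * (1 + (x - m r)\<^sup>2)" for x
      proof -
        \<comment> \<open>A sum-of-squares certificate, used with \<open>y = m r\<close>.\<close>
        have "2 * (1 + x\<^sup>2) * (1 + (x - y)\<^sup>2) - (1 + y\<^sup>2)
            = 1 + (2 * x - y)\<^sup>2 + 2 * (x * (x - y))\<^sup>2" for y :: real
          by (simp add: algebra_simps power2_eq_square)
        moreover have "0 \<le> 1 + (2 * x - y)\<^sup>2 + 2 * (x * (x - y))\<^sup>2" for y :: real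
          by simp
        ultimately have "1 + (m r)\<^sup>2 \<le> 2 * (1 + x\<^sup>2) * (1 + (x - m r)\<^sup>2)"
          by (metis diff_ge_0_iff_ge)
        then show ?thesis using pos[of x] pos[of "m r"] by (simp add: field_simps)
      qed
      then have "(\<integral>x. ?f x \<partial>\<mu> r) \<le> (\<integral>x. 2 / (1 + (m r)\<^sup>2) * (1 + (x - m r)\<^sup>2) \<partial>\<mu> r)"
        using sq(1)[of r] pos by (intro integral_mono') (auto simp: less_imp_le)
      also have "\<dots> = 2 / (1 + (m r)\<^sup>2) * (1 + (\<integral>x. (x - m r)\<^sup>2 \<partial>\<mu> r))"
        using sq(1)[of r] \<mu>.prob_space[of r] by simp
      also have "\<dots> \<le> 2 / (1 + (m r)\<^sup>2) * (1 + C)"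
        using sq(2)[of r] C(2)[of r] pos by (intro mult_left_mono) (auto simp: less_imp_le)
      finally have "e / 2 < 2 / (1 + (m r)\<^sup>2) * (1 + C)" using r by linarith
      then have "1 + (m r)\<^sup>2 < 4 * (1 + C) / e"
        using e pos[of "m r"] by (simp add: field_simps)
      moreover have "\<bar>m r\<bar> \<le> 1 + (m r)\<^sup>2"
        using sum_squares_bound[of "\<bar>m r\<bar>" 1] by simp
      ultimately show "norm (m r) \<le> 1 + 4 * (1 + C) / e" by simp
    qed
    then show ?thesis using C e by (intro BfunI)
  qed
  obtain K where K: "\<And>r. \<bar>m r\<bar> \<le> K"
    using \<open>Bseq m\<close> unfolding Bseq_def real_norm_def by blast
  \<comment> \<open>Treating centres and bounds as points of the plane gives one subsequence along
    which both converge.\<close>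
  have "bounded (range (\<lambda>r. (m r, l r)))"
    by (rule bounded_subset[OF bounded_cbox[of "(-K, 0)" "(K, C)"]])
      (use K C l0 in \<open>auto simp: abs_le_iff minus_le_iff cbox_Pair_eq\<close>)
  from bounded_imp_convergent_subsequence[OF this]
  obtain q s where s: "strict_mono s" "((\<lambda>r. (m r, l r)) \<circ> s) \<longlonglongrightarrow> q" by blast
  define a b where "a = fst q" and "b = snd q"
  have ms: "(\<lambda>r. m (s r)) \<longlonglongrightarrow> a" and ls: "(\<lambda>r. l (s r)) \<longlonglongrightarrow> b"
    using tendsto_fst[OF s(2)] tendsto_snd[OF s(2)] by (simp_all add: a_def b_def comp_def)
  have sub: "(\<lambda>r. u (s r)) \<longlonglongrightarrow> v" if "u \<longlonglongrightarrow> v" for u :: "nat \<Rightarrow> 'b::topological_space" and v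
    using LIMSEQ_subseq_LIMSEQ[OF that s(1)] by (simp add: comp_def)
  have b0: "0 \<le> b" by (rule LIMSEQ_le_const[OF ls]) (use l0 in auto)

  have charb: "norm (char \<nu> t) \<le> 1 / (1 + b * (1 - cos t))" for t
  proof (rule LIMSEQ_le[OF tendsto_norm[OF sub[OF charconv]]])
    have "0 < 1 + b * (1 - cos t)"
      using b0 by (intro add_pos_nonneg mult_nonneg_nonneg) auto
    then show "(\<lambda>r. 1 / (1 + l (s r) * (1 - cos t))) \<longlonglongrightarrow> 1 / (1 + b * (1 - cos t))"
      by (intro tendsto_intros ls) simp
  qed (use char in blast)

  have "(\<lambda>r. \<integral>x. \<bar>sin (pi * x)\<bar> \<partial>\<mu> r) \<longlonglongrightarrow> (\<integral>x. \<bar>sin (pi * x)\<bar> \<partial>\<nu>)"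
    by (rule weak[of _ 1]) (auto intro!: continuous_intros)
  moreover have "(\<integral>x. \<bar>sin (pi * x)\<bar> \<partial>\<mu> r) = 0" for r
    using int[of r] by (intro integral_eq_zero_AE) (auto simp: sin_pi_eq_0_iff)
  ultimately have "(\<integral>x. \<bar>sin (pi * x)\<bar> \<partial>\<nu>) = 0"
    by (simp add: LIMSEQ_const_iff)
  moreover have "integrable \<nu> (\<lambda>x. \<bar>sin (pi * x)\<bar>)"
    by (rule \<nu>.integrable_const_bound[of _ 1]) auto
  ultimately have intb: "AE x in \<nu>. x \<in> \<int>"
    by (subst (asm) integral_nonneg_eq_0_iff_AE) (auto simp: sin_pi_eq_0_iff)

  \<comment> \<open>Weak convergence handles only bounded test functions, hence the cut-off at
    \<open>k\<close>. Replacing the centre \<open>m (s r)\<close> by its limit \<open>a\<close>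
    costs error terms in \<open>d r\<close> that vanish.\<close>
  have trunc: "(\<integral>x. min ((x - a)\<^sup>2) (real k) \<partial>\<nu>) \<le> b" for k
  proof -
    define d where "d r = \<bar>m (s r) - a\<bar>" for r
    have d: "d \<longlonglongrightarrow> 0"
      unfolding d_def using tendsto_rabs_zero[OF LIM_zero[OF ms]] .
    show ?thesis
    proof (rule LIMSEQ_le)
      show "(\<lambda>r. \<integral>x. min ((x - a)\<^sup>2) (real k) \<partial>\<mu> (s r)) \<longlonglongrightarrow> (\<integral>x. min ((x - a)\<^sup>2) (real k) \<partial>\<nu>)"
        by (rule sub, rule weak[of _ "real k"]) (auto intro!: continuous_intros)
      show "(\<lambda>r. (1 + d r) * l (s r) + (d r + (d r)\<^sup>2)) \<longlonglongrightarrow> b"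
        by (rule tendsto_eq_intros d ls refl | simp)+
      have "(\<integral>x. min ((x - a)\<^sup>2) (real k) \<partial>\<mu> (s r)) \<le> (1 + d r) * l (s r) + (d r + (d r)\<^sup>2)" for r
      proof -
        have d0: "d r \<ge> 0" by (simp add: d_def)
        \<comment> \<open>Expand the square around \<open>m (s r)\<close> and absorb the cross term
          by \<open>2 * \<bar>y\<bar> \<le> y^2 + 1\<close>.\<close>
        have "min ((x - a)\<^sup>2) (real k) \<le> (1 + d r) * (x - m (s r))\<^sup>2 + (d r + (d r)\<^sup>2)" for x
        proof -
          define y where "y = x - m (s r)"
          have "(x - a)\<^sup>2 = y\<^sup>2 + 2 * y * (m (s r) - a) + (d r)\<^sup>2"
            by (simp add: y_def d_def power2_eq_square algebra_simps)
          also have "y * (m (s r) - a) \<le> \<bar>y\<bar> * d r"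
            unfolding d_def abs_mult[symmetric] by (rule abs_ge_self)
          then have "2 * y * (m (s r) - a) \<le> (2 * \<bar>y\<bar>) * d r" by simp
          also have "(2 * \<bar>y\<bar>) * d r \<le> (y\<^sup>2 + 1) * d r"
            using sum_squares_bound[of "\<bar>y\<bar>" 1] d0 by (intro mult_right_mono) auto
          finally show ?thesis by (simp add: y_def algebra_simps)
        qed
        then have "(\<integral>x. min ((x - a)\<^sup>2) (real k) \<partial>\<mu> (s r))
            \<le> (\<integral>x. (1 + d r) * (x - m (s r))\<^sup>2 + (d r + (d r)\<^sup>2) \<partial>\<mu> (s r))"
          using sq(1) d0 by (intro integral_mono') auto
        also have "\<dots> = (1 + d r) * (\<integral>x. (x - m (s r))\<^sup>2 \<partial>\<mu> (s r)) + (d r + (d r)\<^sup>2)"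
          using sq(1)[of "s r"] \<mu>.prob_space[of "s r"] by simp
        also have "\<dots> \<le> (1 + d r) * l (s r) + (d r + (d r)\<^sup>2)"
          using sq(2) d0 by (intro add_right_mono mult_left_mono) auto
        finally show ?thesis .
      qed
      then show "\<exists>N. \<forall>r\<ge>N. (\<integral>x. min ((x - a)\<^sup>2) (real k) \<partial>\<mu> (s r)) \<le> (1 + d r) * l (s r) + (d r + (d r)\<^sup>2)"
        by blast
    qed
  qed
  \<comment> \<open>Monotone convergence in the cut-off level yields integrability of the full
    square and the bound \<open>b\<close> at once.\<close>
  define g where "g k x = min ((x - a)\<^sup>2) (real k)" for k x
  have gint: "integrable \<nu> (g k)" for k
    unfolding g_def by (rule \<nu>.integrable_const_bound[of _ "real k"]) auto
  have inc: "incseq (\<lambda>k. \<integral>x. g k x \<partial>\<nu>)"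
    by (intro incseq_SucI integral_mono gint) (auto simp: g_def)
  have "\<forall>k. (\<integral>x. g k x \<partial>\<nu>) \<le> b"
    using trunc by (simp add: g_def)
  then obtain L where L: "(\<lambda>k. \<integral>x. g k x \<partial>\<nu>) \<longlonglongrightarrow> L"
    by (rule incseq_convergent[OF inc]) (rule that)
  have mono: "AE x in \<nu>. mono (\<lambda>k. g k x)"
    unfolding g_def by (intro AE_I2 monoI min.mono) simp_all
  have glim: "AE x in \<nu>. (\<lambda>k. g k x) \<longlonglongrightarrow> (x - a)\<^sup>2"
  proof (intro AE_I2 tendsto_eventually)
    fix x
    obtain k0 :: nat where "(x - a)\<^sup>2 \<le> real k0" using real_arch_simple by blast
    then show "\<forall>\<^sub>F k in sequentially. g k x = (x - a)\<^sup>2"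
      by (intro eventually_sequentiallyI[of k0]) (auto simp: g_def min_def)
  qed
  have meas: "(\<lambda>x. (x - a)\<^sup>2) \<in> borel_measurable \<nu>" by simp
  have "integrable \<nu> (\<lambda>x. (x - a)\<^sup>2)" "(\<integral>x. (x - a)\<^sup>2 \<partial>\<nu>) = L"
    using integrable_monotone_convergence[OF gint mono glim L meas]
      integral_monotone_convergence[OF gint mono glim L meas] by auto
  moreover have "L \<le> b"
    by (rule LIMSEQ_le_const2[OF L]) (use trunc in \<open>auto simp: g_def\<close>)
  ultimately have "dispersed \<nu> a b"
    unfolding dispersed_def using \<nu> intb b0 charb by simp
  then show ?thesis by blast
qed

section \<open>Bernoulli sums and the final inequality\<close>

text \<open>Fourier inversion against the Poisson kernel bounds every point mass by
  \<open>1 / sqrt (1 + 2 * l)\<close>, which gives \<open>2 * l \<le> Delta_inf M X\<close>, and the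
  variance is at most \<open>l\<close>.\<close>

lemma (in prob_space) Delta_inf_bernoulli_sum:
  assumes "bernoulli_sum M X"
  shows "X \<in> borel_measurable M" "AE \<omega> in M. X \<omega> \<in> \<int>"
    and "integrable M X" "integrable M (\<lambda>\<omega>. (X \<omega>)\<^sup>2)" "2 * variance X \<le> Delta_inf M X"
proof -
  show X[measurable]: "X \<in> borel_measurable M" using assms by (simp add: bernoulli_sum_def)
  let ?D = "distr M borel X"
  obtain \<mu> where "\<And>r. finite_bernoulli_sum_law (\<mu> r)" "weak_conv_m \<mu> ?D"
    using assms by (auto simp: bernoulli_sum_def)
  then obtain m l where "dispersed ?D m l"
    using dispersed_weak_limit[of \<mu> ?D] dispersed_finite_bernoulli_sum by auto
  then have int: "AE x in ?D. x \<in> \<int>" and l: "0 \<le> l"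
    and sq': "integrable ?D (\<lambda>x. (x - m)\<^sup>2)" "(\<integral>x. (x - m)\<^sup>2 \<partial>?D) \<le> l"
    and char: "\<And>t. norm (char ?D t) \<le> 1 / (1 + l * (1 - cos t))"
    by (auto simp: dispersed_def)
  interpret D: real_distribution ?D by simp
  show Xint: "AE \<omega> in M. X \<omega> \<in> \<int>"
    using int by (subst (asm) AE_distr_iff) auto
  have sq: "integrable M (\<lambda>\<omega>. (X \<omega> - m)\<^sup>2)" "expectation (\<lambda>\<omega>. (X \<omega> - m)\<^sup>2) \<le> l"
    using sq' by (auto simp: integrable_distr_eq integral_distr)
  have i1: "integrable M (\<lambda>\<omega>. X \<omega> - m)"
    by (rule square_integrable_imp_integrable) (use sq in auto)
  then have "integrable M (\<lambda>\<omega>. (X \<omega> - m) + m)" by (intro Bochner_Integration.integrable_add) auto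
  then show iX: "integrable M X" by simp
  have "integrable M (\<lambda>\<omega>. (X \<omega> - m)\<^sup>2 + 2 * m * X \<omega> - m\<^sup>2)"
    using sq(1) iX by auto
  then show iX2: "integrable M (\<lambda>\<omega>. (X \<omega>)\<^sup>2)"
    by (simp add: power2_diff algebra_simps)
  \<comment> \<open>The centre \<open>m\<close> may differ from the mean, but the variance is the
    smallest second moment about any point.\<close>
  have "expectation (\<lambda>\<omega>. (X \<omega> - m)\<^sup>2) = variance X + (expectation X - m)\<^sup>2"
    using iX iX2 by (simp add: variance_eq) (simp add: power2_diff prob_space)
  then have var: "variance X \<le> l"
    using sq(2) zero_le_power2[of "expectation X - m"] by linarith

  define f where "f k = measure M {\<omega> \<in> space M. X \<omega> = of_int k}" for k :: int
  have f: "f k \<le> 1 / sqrt (1 + 2 * l)" for k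
  proof -
    have "f k = measure ?D {of_int k}"
      by (auto simp: f_def measure_distr intro!: arg_cong[where f=prob])
    moreover have "2 * pi * measure ?D {of_int k} \<le> 2 * pi / sqrt (1 + 2 * l)"
      using D.lattice_mass_le_char_integral[OF int poisson_kernel_integral(1)[OF l] char]
      by (simp add: poisson_kernel_integral(2)[OF l])
    ultimately have "2 * pi * f k \<le> 2 * pi * (1 / sqrt (1 + 2 * l))" by simp
    then show ?thesis by (rule mult_left_le_imp_le) simp
  qed
  have Sup: "(SUP k. f k) \<le> 1 / sqrt (1 + 2 * l)" by (rule cSUP_least) (use f in auto)
  have pos: "0 < (SUP k. f k)" using lattice_sup_pos[OF X Xint] by (simp add: f_def)
  have "(SUP k. f k)\<^sup>2 \<le> (1 / sqrt (1 + 2 * l))\<^sup>2"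
    using Sup pos by (intro power_mono) auto
  also have "\<dots> = 1 / (1 + 2 * l)" using l by (simp add: power_divide)
  finally have "1 + 2 * l \<le> 1 / (SUP k. f k)\<^sup>2"
    using pos l by (simp add: field_simps)
  then show "2 * variance X \<le> Delta_inf M X"
    using var by (simp add: Delta_inf_def f_def)
qed

theorem theorem4p13:
  fixes M :: "'a measure" and X :: "nat \<Rightarrow> 'a \<Rightarrow> real" and n :: nat
  assumes "prob_space M"
    and "n \<ge> 1"
    and "\<forall>i\<in>{1..n}. bernoulli_sum M (X i)"
    and "prob_space.indep_vars M (\<lambda>_. borel) X {1..n}"
  shows "Delta_inf M (\<lambda>\<omega>. \<Sum>i=1..n. X i \<omega>) \<le> 6 * (\<Sum>i=1..n. Delta_inf M (X i))"
proof -
  interpret prob_space M by fact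
  let ?Y = "\<lambda>\<omega>. \<Sum>i=1..n. X i \<omega>"
  have X: "X i \<in> borel_measurable M" "AE \<omega> in M. X i \<omega> \<in> \<int>"
    "integrable M (X i)" "integrable M (\<lambda>\<omega>. (X i \<omega>)\<^sup>2)" "2 * variance (X i) \<le> Delta_inf M (X i)"
    if "i \<in> {1..n}" for i
  proof -
    have "bernoulli_sum M (X i)" using assms(3) that by blast
    note bs = Delta_inf_bernoulli_sum[OF this]
    show "X i \<in> borel_measurable M" by (rule bs(1))
    show "AE \<omega> in M. X i \<omega> \<in> \<int>" by (rule bs(2))
    show "integrable M (X i)" by (rule bs(3))
    show "integrable M (\<lambda>\<omega>. (X i \<omega>)\<^sup>2)" by (rule bs(4))
    show "2 * variance (X i) \<le> Delta_inf M (X i)" by (rule bs(5))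
  qed
  have Y[measurable]: "?Y \<in> borel_measurable M"
    using X(1) by (intro borel_measurable_sum) auto
  have "AE \<omega> in M. \<forall>i\<in>{1..n}. X i \<omega> \<in> \<int>"
    using X(2) by (intro AE_finite_allI) auto
  then have Yint: "AE \<omega> in M. ?Y \<omega> \<in> \<int>"
    by eventually_elim (rule Ints_sum, blast)
  have iY: "integrable M ?Y" "integrable M (\<lambda>\<omega>. (?Y \<omega>)\<^sup>2)"
    and var: "variance ?Y = (\<Sum>i=1..n. variance (X i))"
    using variance_sum_indep[OF _ assms(4) X(3,4)] X(3) by auto
  \<comment> \<open>The lattice bound is applied with the mean as centre and with the supremum of
    the point masses as \<open>L\<close>. Half of the factor 12 is spent on
    \<open>2 * variance (X i) \<le> Delta_inf M (X i)\<close>, leaving 6.\<close>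
  have "Delta_inf M ?Y \<le> 12 * variance ?Y"
    unfolding Delta_inf_def
  proof (rule lattice_variance_lower_bound[OF Y Yint])
    show "integrable M (\<lambda>\<omega>. (?Y \<omega> - expectation ?Y)\<^sup>2)"
      using iY by (simp add: power2_diff)
    show "0 < (SUP k::int. prob {\<omega> \<in> space M. ?Y \<omega> = of_int k})"
      by (rule lattice_sup_pos[OF Y Yint])
    show "prob {\<omega> \<in> space M. ?Y \<omega> = of_int k} \<le> (SUP k::int. prob {\<omega> \<in> space M. ?Y \<omega> = of_int k})" for k
      by (rule cSUP_upper[OF UNIV_I bdd_aboveI2[where M=1]]) simp
  qed
  also have "\<dots> = 6 * (\<Sum>i=1..n. 2 * variance (X i))"
    unfolding var sum_distrib_left[symmetric] by simp
  also have "\<dots> \<le> 6 * (\<Sum>i=1..n. Delta_inf M (X i))"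
    using X(5) by (intro mult_left_mono sum_mono) auto
  finally show ?thesis .
qed

end
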